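(* Let $s,h,t$ be positive integers with $t\mid h$ and $s<h$, and let $q=2^h$. Assume that $\mathbb{F}_q$ is the splitting field of $g(x)=x^{2^s+1}+ax^{2^s}+bx^{2^s-1}+c\in\mathbb{F}_{2^t}[x]$ with $b,c\ne0$, that $\alpha_1,\dots,\alpha_{2^s+1}$ are all the roots of $g(x)$ and are pairwise distinct, and let $v_i=(\alpha_i^{2^{s-1}}+b^{2^{h-1}}\alpha_i^{2^{s-1}-1})^{-1}$ for $1\le i\le 2^s+1$. Let $\boldsymbol{\alpha}=(\alpha_1,\dots,\alpha_{2^s+1})$, $\boldsymbol{v}=(v_1,\dots,v_{2^s+1})$, $\eta_2\in\mathbb{F}_q^*$, and $$\mathcal{S}_1=\Big\{\sum_{i=0}^{2^{s-1}-1}f_ix^i+f_{2^{s-1}-1}\,\eta_2\big((b^{2^{h-1}}+a)x^{2^{s-1}}+x^{2^{s-1}+1}\big): f_i\in\mathbb{F}_q\text{ for }0\le i\le2^{s-1}-1\Big\},$$ and let $\mathcal{C}_1=ev_{\boldsymbol{\alpha},\boldsymbol{v}}(\mathcal{S}_1)$. Then there exists a $[[2^s+1,\,1,\,\mathrm{wt}(\mathcal{C}_1^\perp\setminus\mathcal{C}_1)]]_q$ quantum stabilizer code.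
   Context: $ev_{\boldsymbol{\alpha},\boldsymbol{v}}(f)=(v_1f(\alpha_1),\dots,v_nf(\alpha_n))$. $\mathcal{C}^\perp$ is the Euclidean dual. For a set $X$ of vectors, $\mathrm{wt}(X)$ is the minimum Hamming weight of a nonzero element of $X$. Quantum codes: let $q=p^h$, $\zeta=e^{2\pi i/p}$, $\mathrm{Tr}:\mathbb{F}_q\to\mathbb{F}_p$ the trace; on $\mathbb{C}^q$ with orthonormal basis $\{|x\rangle:x\in\mathbb{F}_q\}$ let $X(a)|x\rangle=|x+a\rangle$, $Z(b)|x\rangle=\zeta^{\mathrm{Tr}(bx)}|x\rangle$, and for $\boldsymbol{a},\boldsymbol{b}\in\mathbb{F}_q^n$ let $X(\boldsymbol{a})=\bigotimes X(a_i)$, $Z(\boldsymbol{b})=\bigotimes Z(b_i)$ on $(\mathbb{C}^q)^{\otimes n}$. The error group consists of all $\zeta^cX(\boldsymbol{a})Z(\boldsymbol{b})$; the weight of such an element is the number of $i$ with $(a_i,b_i)\neq(0,0)$. A stabilizer code is a nonzero joint $+1$-eigenspace of an abelian subgroup of the error group. It is an $[[n,K,d]]_q$ code if it has dimension $q^K$ and minimum distance $d$, i.e. $d$ is the largest integer such that every error $E$ of weight less than $d$ is detectable ($PEP=c_EP$ for a scalar $c_E$, $P$ the orthogonal projector onto the code). *)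

theory Defs
  imports
    "HOL-Algebra.Algebraic_Closure_Type"
    "HOL-Algebra.Generated_Fields"
    "HOL-Analysis.Analysis"
begin

definition is_splitting_field :: "'a::field set \<Rightarrow> 'a poly \<Rightarrow> bool" where
  "is_splitting_field K p \<longleftrightarrow>
     subfield K ring_of_type_algebra \<and>
     p \<noteq> 0 \<and> (\<forall>i. poly.coeff p i \<in> K) \<and>
     (\<exists>A. p = Polynomial.smult (lead_coeff p) (\<Prod>r\<in>#A. [:- r, 1:])) \<and>
     generate_field ring_of_type_algebra (K \<union> {x. poly p x = 0}) = UNIV"

definition hamming_weight :: "'a::zero ^ 'n::finite \<Rightarrow> nat" where
  "hamming_weight x = card {i. x $ i \<noteq> 0}"

definition min_weight :: "('a::{zero,finite} ^ 'n::finite) set \<Rightarrow> nat" where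
  "min_weight W = Min (hamming_weight ` (W - {0}))"

definition euclidean_dual :: "('a::comm_ring_1 ^ 'n::finite) set \<Rightarrow> ('a ^ 'n) set" where
  "euclidean_dual C = {y. \<forall>x\<in>C. (\<Sum>i\<in>UNIV. x $ i * y $ i) = 0}"

definition ev :: "'a::comm_ring_1 ^ 'n::finite \<Rightarrow> 'a ^ 'n \<Rightarrow> 'a poly \<Rightarrow> 'a ^ 'n" where
  "ev \<alpha> v f = (\<chi> i. v $ i * poly f (\<alpha> $ i))"

definition field_degree :: "'a::{field,finite} itself \<Rightarrow> nat" where
  "field_degree _ = (THE h. CARD('a) = CHAR('a) ^ h)"

definition field_trace :: "'a::{field,finite} \<Rightarrow> 'a" where
  "field_trace x = (\<Sum>i<field_degree TYPE('a). x ^ (CHAR('a) ^ i))"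

text \<open>The trace lies in the prime field; its representative in \<open>{0..<p}\<close> is
  used as an exponent of \<open>\<zeta>\<close>.\<close>

definition trace_exponent :: "'a::{field,finite} \<Rightarrow> nat" where
  "trace_exponent x = (THE k. k < CHAR('a) \<and> of_nat k = field_trace x)"

definition zeta :: "'a::{field,finite} itself \<Rightarrow> complex" where
  "zeta _ = exp (2 * of_real pi * \<i> / of_nat CHAR('a))"

text \<open>The standard basis vectors of \<open>complex ^ 'a\<close> are the kets indexed by the field;
  the \<open>n\<close>-fold tensor power is \<open>complex ^ ('a ^ 'n)\<close>, where the index
  \<open>x\<close> stands for the product ket of the \<open>x $ i\<close>.  The entry \<open>A $ y $ x\<close> of an
  operator is the coefficient of ket \<open>y\<close> in the image of ket \<open>x\<close>.\<close>

type_synonym 'm operator = "((complex, 'm) vec, 'm) vec"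

definition X_op :: "'a::{field,finite} \<Rightarrow> 'a operator" where
  "X_op a = (\<chi> y x. if y = x + a then 1 else 0)"

definition Z_op :: "'a::{field,finite} \<Rightarrow> 'a operator" where
  "Z_op b = (\<chi> y x. if y = x then zeta TYPE('a) ^ trace_exponent (b * x) else 0)"

definition tensor_op ::
  "('n::finite \<Rightarrow> 'a::finite operator) \<Rightarrow> ('a ^ 'n) operator" where
  "tensor_op A = (\<chi> y x. \<Prod>i\<in>UNIV. A i $ (y $ i) $ (x $ i))"

definition scale_op :: "complex \<Rightarrow> 'm::finite operator \<Rightarrow> 'm operator" where
  "scale_op c = map_matrix (\<lambda>z. c * z)"

definition error_op ::
  "nat \<Rightarrow> 'a::{field,finite} ^ 'n::finite \<Rightarrow> 'a ^ 'n \<Rightarrow> ('a ^ 'n) operator" where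
  "error_op c a b = scale_op (zeta TYPE('a) ^ c)
     (tensor_op (\<lambda>i. X_op (a $ i)) ** tensor_op (\<lambda>i. Z_op (b $ i)))"

definition error_group :: "(('a::{field,finite} ^ 'n::finite) operator) monoid" where
  "error_group = \<lparr>carrier = {error_op c a b | c a b. True}, monoid.mult = (**), one = mat 1\<rparr>"

definition error_weight :: "'a::zero ^ 'n::finite \<Rightarrow> 'a ^ 'n \<Rightarrow> nat" where
  "error_weight a b = card {i. (a $ i, b $ i) \<noteq> (0, 0)}"

definition is_stabilizer_code :: "(complex ^ ('a::{field,finite} ^ 'n::finite)) set \<Rightarrow> bool" where
  "is_stabilizer_code Q \<longleftrightarrow>
     (\<exists>S. subgroup S error_group \<and> (\<forall>E\<in>S. \<forall>F\<in>S. E ** F = F ** E) \<and>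
          Q = {v. \<forall>E\<in>S. E *v v = v} \<and> Q \<noteq> {0})"

definition hermitian_inner :: "complex ^ 'm::finite \<Rightarrow> complex ^ 'm \<Rightarrow> complex" where
  "hermitian_inner v w = (\<Sum>i\<in>UNIV. cnj (v $ i) * w $ i)"

definition is_orthogonal_projector ::
  "'m::finite operator \<Rightarrow> (complex ^ 'm) set \<Rightarrow> bool" where
  "is_orthogonal_projector P Q \<longleftrightarrow>
     (\<forall>v. P *v v \<in> Q \<and> (\<forall>w\<in>Q. hermitian_inner w (v - P *v v) = 0))"

definition detectable :: "(complex ^ 'm::finite) set \<Rightarrow> 'm operator \<Rightarrow> bool" where
  "detectable Q E \<longleftrightarrow>
     (\<exists>P c. is_orthogonal_projector P Q \<and> P ** E ** P = scale_op c P)"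

definition detects_below :: "(complex ^ ('a::{field,finite} ^ 'n::finite)) set \<Rightarrow> nat \<Rightarrow> bool" where
  "detects_below Q d \<longleftrightarrow>
     (\<forall>c a b. error_weight a b < d \<longrightarrow> detectable Q (error_op c a b))"

definition has_min_distance ::
  "(complex ^ ('a::{field,finite} ^ 'n::finite)) set \<Rightarrow> nat \<Rightarrow> bool" where
  "has_min_distance Q d \<longleftrightarrow>
     detects_below Q d \<and> (\<forall>d'. detects_below Q d' \<longrightarrow> d' \<le> d)"

text \<open>\<open>Q\<close> is an \<open>[[n, k, d]]\<close> stabilizer code over the alphabet size \<open>q = CARD('a)\<close>.\<close>

definition stabilizer_code_params ::
  "(complex ^ ('a::{field,finite} ^ 'n::finite)) set \<Rightarrow> nat \<Rightarrow> nat \<Rightarrow> nat \<Rightarrow> bool" where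
  "stabilizer_code_params Q n k d \<longleftrightarrow>
     is_stabilizer_code Q \<and> n = CARD('n) \<and> vec.dim Q = CARD('a) ^ k \<and> has_min_distance Q d"

end

theory Submission
  imports Defs "HOL-Number_Theory.Residues"
begin

text \<open>
  Put \<open>m = 2 ^ (s - 1)\<close>, so that \<open>n = 2 * m + 1\<close>.  In characteristic 2 the derivative of \<open>g\<close> is
  \<open>(x ^ m + sqrt b * x ^ (m - 1))\<^sup>2\<close>, hence \<open>v\<^sub>i\<^sup>2 = 1 / g'(\<alpha>\<^sub>i)\<close>, and by Lagrange
  interpolation \<open>\<Sum>\<^sub>i v\<^sub>i\<^sup>2 F(\<alpha>\<^sub>i)\<close> is the coefficient of \<open>x ^ (n - 1)\<close> in \<open>F mod g\<close>.  For a product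
  of two elements of \<open>S\<^sub>1\<close> this coefficient has two equal cross terms, which cancel, and the term
  of the squared twist, which vanishes because the coefficient \<open>sqrt b + a\<close> squares to \<open>b + a\<^sup>2\<close>.  So
  \<open>C\<^sub>1\<close> is a self-orthogonal code of dimension \<open>m\<close>, and the errors \<open>X(x) Z(z)\<close> with
  \<open>x, z \<in> C\<^sub>1\<close> form the stabilizer group.  The code it fixes consists of the vectors supported on the
  dual and constant on the cosets of \<open>C\<^sub>1\<close>.
\<close>

no_notation fps_nth (infixl "$" 75)

section \<open>The trace character of a finite field\<close>

text \<open>Multiplication by a nonzero \<open>x\<close> permutes the units, so the product of all
  units absorbs one factor \<open>x\<close> per unit. Cancelling that product leaves Fermat's
  theorem for the field.\<close>

lemma power_CARD_eq_same:
  fixes x :: "'a::{field,finite}"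
  shows "x ^ CARD('a) = x"
proof (cases "x = 0")
  case False
  have "bij_betw ((*) x) (- {0}) (- {0})"
    by (rule bij_betw_byWitness[where f' = "\<lambda>y. y / x"]) (use False in auto)
  then have "(\<Prod>y\<in>-{0}. x * y) = (\<Prod>y\<in>-{0::'a}. y)"
    by (rule prod.reindex_bij_betw)
  then have "x ^ card (- {0::'a}) * (\<Prod>y\<in>-{0}. y) = (\<Prod>y\<in>-{0}. y)"
    by (simp only: prod.distrib prod_constant)
  moreover have "(\<Prod>y\<in>-{0::'a}. y) \<noteq> 0"
    by simp
  ultimately have "x ^ card (- {0::'a}) = 1"
    by simp
  moreover have "CARD('a) = Suc (card (- {0::'a}))"
    unfolding Compl_eq_Diff_UNIV by (rule card_Suc_Diff1[symmetric]) auto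
  ultimately show ?thesis
    by simp
qed (simp add: power_0_left)

lemma CHAR_prime_finite: "prime CHAR('a::{field,finite})"
  by (simp add: finite_imp_CHAR_pos prime_CHAR_semidom)

lemma field_degree_eq:
  assumes "CARD('a::{field,finite}) = CHAR('a) ^ e"
  shows "field_degree TYPE('a) = e"
  unfolding field_degree_def using assms prime_gt_1_nat[OF CHAR_prime_finite[where 'a='a]]
  by (intro the_equality) auto

lemma field_trace_add:
  fixes x y :: "'a::{field,finite}"
  shows "field_trace (x + y) = field_trace x + field_trace y"
  by (simp add: field_trace_def freshmans_dream'[OF CHAR_prime_finite refl] sum.distrib)

text \<open>Frobenius permutes the conjugates of \<open>x\<close> cyclically, the last one returning
  to \<open>x\<close> itself. This places the trace in the prime field.\<close>

lemma field_trace_power_CHAR: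
  fixes x :: "'a::{field,finite}"
  assumes "CARD('a) = CHAR('a) ^ e"
  shows "field_trace x ^ CHAR('a) = field_trace x"
proof -
  let ?p = "CHAR('a)"
  have "field_trace x ^ ?p = (\<Sum>i<e. x ^ (?p ^ Suc i))"
    unfolding field_trace_def field_degree_eq[OF assms] freshmans_dream_sum[OF CHAR_prime_finite refl]
    by (simp add: power_Suc2 power_mult del: power_Suc)
  also have "\<dots> = (\<Sum>i<e. x ^ (?p ^ i)) + x ^ (?p ^ e) - x"
    using sum.lessThan_Suc_shift[of "\<lambda>i. x ^ (?p ^ i)" e] by simp
  also have "\<dots> = field_trace x"
    using assms power_CARD_eq_same[of x] by (simp add: field_trace_def field_degree_eq[OF assms])
  finally show ?thesis .
qed

text \<open>The images of \<open>0, ..., p - 1\<close> are \<open>p\<close> distinct roots of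
  \<open>X ^ p - X\<close>, and a polynomial of that degree has no room for further roots.\<close>

lemma power_CHAR_fixed_imp_of_nat:
  fixes y :: "'a::{field,finite}"
  assumes "y ^ CHAR('a) = y"
  obtains k where "k < CHAR('a)" "of_nat k = y"
proof -
  let ?p = "CHAR('a)"
  let ?f = "Polynomial.monom 1 ?p - Polynomial.monom 1 1 :: 'a poly"
  have p: "1 < ?p"
    by (rule prime_gt_1_nat[OF CHAR_prime_finite])
  have deg: "Polynomial.degree ?f \<le> ?p"
  proof (rule degree_diff_le)
    show "Polynomial.degree (Polynomial.monom (1::'a) ?p) \<le> ?p"
      by (rule degree_monom_le)
    show "Polynomial.degree (Polynomial.monom (1::'a) 1) \<le> ?p"
      using degree_monom_le[of "1::'a" 1] p by linarith
  qed
  have "Polynomial.coeff ?f ?p = 1"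
    using p unfolding coeff_diff coeff_monom by simp
  then have nz: "?f \<noteq> 0"
    by (metis coeff_0 one_neq_zero)
  \<comment> \<open>Frobenius is additive, and \<open>of_nat k\<close> is a sum of \<open>k\<close>
    ones.\<close>
  have fermat: "of_nat k ^ ?p = (of_nat k :: 'a)" for k
    using freshmans_dream_sum[OF CHAR_prime_finite refl, of "\<lambda>_. 1 :: 'a" "{..<k}"]
    unfolding sum_constant card_lessThan power_one mult_1_right .
  have "inj_on (of_nat :: nat \<Rightarrow> 'a) {..<?p}"
  proof (rule inj_onI)
    fix i j assume "i \<in> {..<?p}" "j \<in> {..<?p}" "of_nat i = (of_nat j :: 'a)"
    then show "i = j"
      unfolding of_nat_eq_iff_cong_CHAR cong_def lessThan_iff by (metis mod_less)
  qed
  then have card: "card ((of_nat :: nat \<Rightarrow> 'a) ` {..<?p}) = ?p"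
    by (simp add: card_image)
  have roots: "{x. poly ?f x = 0} = {x. x ^ ?p = x}"
    unfolding poly_diff poly_monom mult_1_left power_one_right right_minus_eq ..
  have "card {x::'a. x ^ ?p = x} \<le> ?p"
    using card_poly_roots_bound[OF nz] deg unfolding roots by linarith
  moreover have "of_nat ` {..<?p} \<subseteq> {x::'a. x ^ ?p = x}"
    using fermat by blast
  ultimately have "of_nat ` {..<?p} = {x::'a. x ^ ?p = x}"
    using card by (intro card_seteq finite) (simp_all only:)
  then have "y \<in> of_nat ` {..<?p}"
    using assms by (simp only: mem_Collect_eq)
  then show ?thesis
    using that by blast
qed

text \<open>This justifies the definite description: Frobenius fixes the trace, which gives
  existence, and representatives below the characteristic are unique modulo it.\<close>

lemma trace_exponent:
  fixes x :: "'a::{field,finite}"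
  assumes "CARD('a) = CHAR('a) ^ e"
  shows "trace_exponent x < CHAR('a)" "of_nat (trace_exponent x) = field_trace x"
proof -
  have "\<exists>!k. k < CHAR('a) \<and> of_nat k = field_trace x"
  proof (rule ex_ex1I)
    show "\<exists>k. k < CHAR('a) \<and> of_nat k = field_trace x"
      using power_CHAR_fixed_imp_of_nat[OF field_trace_power_CHAR[OF assms]] by metis
    show "k = l" if "k < CHAR('a) \<and> of_nat k = field_trace x" "l < CHAR('a) \<and> of_nat l = field_trace x" for k l
      using that of_nat_eq_iff_cong_CHAR[of k l, where 'a='a] by (auto simp: cong_def)
  qed
  from theI'[OF this] show "trace_exponent x < CHAR('a)" "of_nat (trace_exponent x) = field_trace x"
    unfolding trace_exponent_def by blast+
qed

text \<open>The trace is given by a nonzero polynomial of degree \<open>p ^ (e - 1)\<close>, smaller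
  than the number of field elements, so it cannot vanish everywhere.\<close>

lemma field_trace_nonzero:
  assumes "CARD('a::{field,finite}) = CHAR('a) ^ e"
  shows "\<exists>x::'a. field_trace x \<noteq> 0"
proof (rule ccontr)
  let ?p = "CHAR('a)"
  assume trace_0: "\<not> ?thesis"
  let ?f = "(\<Sum>i<e. Polynomial.monom 1 (?p ^ i)) :: 'a poly"
  have p: "1 < ?p"
    by (rule prime_gt_1_nat[OF CHAR_prime_finite])
  have "1 < CARD('a)"
    using card_mono[of UNIV "{0, 1 :: 'a}"] by simp
  then have e: "0 < e"
    using assms by (cases e) auto
  have "Polynomial.degree ?f \<le> ?p ^ (e - 1)"
    using p by (intro degree_sum_le) (auto simp: degree_monom_eq intro!: power_increasing)
  also have "\<dots> < CARD('a)"
    using p e by (simp add: assms)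
  finally have deg: "Polynomial.degree ?f < CARD('a)" .
  have "poly ?f x = field_trace x" for x
    by (simp add: field_trace_def field_degree_eq[OF assms] poly_sum poly_monom)
  then have zero: "poly ?f x = poly 0 x" for x
    using trace_0 by simp
  have "?f = 0"
    by (rule poly_eqI_degree[OF zero deg]) simp
  moreover have "Polynomial.coeff ?f (?p ^ (e - 1)) = 1"
  proof -
    have "Polynomial.coeff ?f (?p ^ (e - 1)) = (\<Sum>i<e. if i = e - 1 then 1 else 0)"
      unfolding coeff_sum using p by (intro sum.cong) auto
    then show ?thesis
      using e by simp
  qed
  ultimately show False
    by simp
qed

section \<open>Roots of unity and the canonical additive character\<close>

lemma zeta_power_eq_1_iff: "zeta TYPE('a::{field,finite}) ^ k = 1 \<longleftrightarrow> CHAR('a) dvd k"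
proof -
  have "zeta TYPE('a) ^ k = exp (2 * of_real pi * \<i> * of_nat k / of_nat CHAR('a))"
    unfolding zeta_def exp_of_nat_mult[symmetric] by (rule arg_cong[of _ _ exp]) simp
  then show ?thesis
    using complex_root_unity_eq_1[of "CHAR('a)" k] prime_gt_0_nat[OF CHAR_prime_finite[where 'a='a]]
    by simp
qed

lemma zeta_power_cong:
  assumes "[i = j] (mod CHAR('a::{field,finite}))"
  shows "zeta TYPE('a) ^ i = zeta TYPE('a) ^ j"
proof -
  have "zeta TYPE('a) ^ k = zeta TYPE('a) ^ (k mod CHAR('a))" for k
    by (subst mult_div_mod_eq[of "CHAR('a)" k, symmetric], subst power_add, subst power_mult)
      (simp add: zeta_power_eq_1_iff[THEN iffD2])
  then show ?thesis
    using assms unfolding cong_def by metis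
qed

text \<open>This is the canonical additive character of the field; \<open>Z_op b\<close> is the
  diagonal matrix of its values at \<open>b * x\<close>.\<close>

definition additive_char :: "'a::{field,finite} \<Rightarrow> complex" where
  "additive_char x = zeta TYPE('a) ^ trace_exponent x"

text \<open>Trace exponents add only modulo the characteristic, but powers of \<open>zeta\<close>
  depend on the exponent only modulo the characteristic.\<close>

lemma additive_char_add:
  fixes x y :: "'a::{field,finite}"
  assumes "CARD('a) = CHAR('a) ^ e"
  shows "additive_char (x + y) = additive_char x * additive_char y"
proof -
  have "of_nat (trace_exponent (x + y)) = (of_nat (trace_exponent x + trace_exponent y) :: 'a)"
    by (simp add: trace_exponent(2)[OF assms] field_trace_add)
  then show ?thesis
    unfolding additive_char_def power_add[symmetric] of_nat_eq_iff_cong_CHAR by (rule zeta_power_cong)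
qed

lemma additive_char_nontrivial:
  assumes "CARD('a::{field,finite}) = CHAR('a) ^ e"
  shows "\<exists>x::'a. additive_char x \<noteq> 1"
proof -
  obtain x :: 'a where x: "field_trace x \<noteq> 0"
    using field_trace_nonzero[OF assms] by blast
  then have "\<not> CHAR('a) dvd trace_exponent x"
    unfolding of_nat_eq_0_iff_char_dvd[where 'a='a, symmetric] trace_exponent[OF assms] .
  then show ?thesis
    unfolding additive_char_def zeta_power_eq_1_iff[symmetric] by blast
qed

lemma additive_char_0:
  assumes "CARD('a::{field,finite}) = CHAR('a) ^ e"
  shows "additive_char (0::'a) = 1"
proof -
  have "additive_char (0::'a) \<noteq> 0"
    by (simp add: additive_char_def zeta_def)
  then show ?thesis
    using additive_char_add[OF assms, of 0 0] by simp
qed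

section \<open>Duals and error operators\<close>

definition dot :: "'a::comm_ring_1 ^ 'n::finite \<Rightarrow> 'a ^ 'n \<Rightarrow> 'a" where
  "dot x y = (\<Sum>i\<in>UNIV. x $ i * y $ i)"

lemma dot_simps [simp]:
  "dot (x + x') y = dot x y + dot x' y" "dot x (y + y') = dot x y + dot x y'"
  "dot (x - x') y = dot x y - dot x' y" "dot x (y - y') = dot x y - dot x y'"
  "dot (- x) y = - dot x y" "dot x (- y) = - dot x y"
  "dot (r *s x) y = r * dot x y" "dot x (r *s y) = r * dot x y"
  "dot 0 y = 0" "dot x 0 = 0"
  by (simp_all add: dot_def algebra_simps sum.distrib sum_subtractf sum_negf sum_distrib_left)

lemma dot_commute: "dot x y = dot y x"
  by (simp add: dot_def mult.commute)

lemma in_euclidean_dual_iff: "y \<in> euclidean_dual C \<longleftrightarrow> (\<forall>x\<in>C. dot x y = 0)"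
  by (simp add: euclidean_dual_def dot_def)

lemma subspace_euclidean_dual: "vec.subspace (euclidean_dual C)"
  by (auto simp: vec.subspace_def in_euclidean_dual_iff)

lemma euclidean_dual_UNIV: "euclidean_dual UNIV = {0 :: 'a::comm_ring_1 ^ 'n::finite}"
proof -
  have "dot (axis i 1) y = y $ i" for y :: "'a ^ 'n" and i
    by (simp add: dot_def axis_def if_distrib[of "\<lambda>x. x * _"] cong: if_cong)
  then show ?thesis
    by (auto simp: in_euclidean_dual_iff vec_eq_iff) metis
qed

context
  fixes e :: nat
  assumes CARD_eq: "CARD('a::{field,finite}) = CHAR('a) ^ e"
begin

lemmas additive_char_add' = additive_char_add[OF CARD_eq]

lemma additive_char_sum:
  fixes f :: "'i \<Rightarrow> 'a"
  shows "additive_char (sum f A) = (\<Prod>i\<in>A. additive_char (f i))"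
  by (induction A rule: infinite_finite_induct)
    (simp_all add: additive_char_0[OF CARD_eq] additive_char_add')

text \<open>Error operators see an inner product only through the character. Nothing is lost on a
  subspace: a nonzero \<open>dot x y\<close> can be rescaled within \<open>C\<close> to any field
  element, in particular to one with a nontrivial character value.\<close>

lemma euclidean_dual_iff_char:
  fixes C :: "('a ^ 'n::finite) set"
  assumes "vec.subspace C"
  shows "y \<in> euclidean_dual C \<longleftrightarrow> (\<forall>x\<in>C. additive_char (dot x y) = 1)"
proof
  assume *: "\<forall>x\<in>C. additive_char (dot x y) = 1"
  show "y \<in> euclidean_dual C"
    unfolding in_euclidean_dual_iff
  proof (intro ballI, rule ccontr)
    fix x assume x: "x \<in> C" and nz: "dot x y \<noteq> 0"
    obtain z :: 'a where z: "additive_char z \<noteq> 1"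
      using additive_char_nontrivial[OF CARD_eq] by blast
    have "(z / dot x y) *s x \<in> C"
      by (rule vec.subspace_scale[OF assms x])
    then have "additive_char (dot ((z / dot x y) *s x) y) = 1"
      using * by blast
    then show False
      using z nz by simp
  qed
qed (simp add: in_euclidean_dual_iff additive_char_0[OF CARD_eq])

text \<open>Orthogonality of characters: translating the sum by some \<open>x0\<close> in
  \<open>C\<close> with nontrivial character value multiplies it by that value, so it must be
  zero.\<close>

lemma sum_additive_char_subspace:
  fixes C :: "('a ^ 'n::finite) set"
  assumes C: "vec.subspace C"
  shows "(\<Sum>x\<in>C. additive_char (dot x y)) = (if y \<in> euclidean_dual C then of_nat (card C) else 0)"
proof (cases "y \<in> euclidean_dual C")
  case True
  then show ?thesis
    using euclidean_dual_iff_char[OF C, of y] by simp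
next
  case False
  then obtain x0 where x0: "x0 \<in> C" "additive_char (dot x0 y) \<noteq> 1"
    using euclidean_dual_iff_char[OF C] by blast
  have "bij_betw (\<lambda>x. x + x0) C C"
    using x0 C by (intro bij_betw_byWitness[where f' = "\<lambda>x. x - x0"])
      (auto intro: vec.subspace_add vec.subspace_diff)
  then have "(\<Sum>x\<in>C. additive_char (dot (x + x0) y)) = (\<Sum>x\<in>C. additive_char (dot x y))"
    by (rule sum.reindex_bij_betw)
  then have "(\<Sum>x\<in>C. additive_char (dot x y)) * additive_char (dot x0 y)
      = (\<Sum>x\<in>C. additive_char (dot x y))"
    by (simp add: additive_char_add' sum_distrib_right)
  then have "(\<Sum>x\<in>C. additive_char (dot x y)) * (additive_char (dot x0 y) - 1) = 0"
    unfolding right_diff_distrib mult_1_right right_minus_eq .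
  then have "(\<Sum>x\<in>C. additive_char (dot x y)) = 0"
    using x0(2) unfolding mult_eq_0_iff right_minus_eq by blast
  then show ?thesis
    unfolding if_not_P[OF False] .
qed

text \<open>Double counting of the character sum over pairs in \<open>C \<times> UNIV\<close>.\<close>

lemma card_mult_card_euclidean_dual:
  fixes C :: "('a ^ 'n::finite) set"
  assumes C: "vec.subspace C"
  shows "card C * card (euclidean_dual C) = CARD('a) ^ CARD('n)"
proof -
  have "complex_of_nat (card C * card (euclidean_dual C))
      = (\<Sum>y\<in>UNIV. \<Sum>x\<in>C. additive_char (dot x y))"
    unfolding sum_additive_char_subspace[OF C] by (simp add: sum.If_cases)
  also have "\<dots> = (\<Sum>x\<in>C. \<Sum>y\<in>UNIV. additive_char (dot y x))"
    by (subst sum.swap) (simp add: dot_commute)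
  also have "\<dots> = (\<Sum>x\<in>C. if x = 0 then of_nat CARD('a ^ 'n) else 0)"
    unfolding sum_additive_char_subspace[OF vec.subspace_UNIV] euclidean_dual_UNIV by simp
  also have "\<dots> = of_nat (CARD('a) ^ CARD('n))"
    using vec.subspace_0[OF C] by simp
  finally show ?thesis
    unfolding of_nat_eq_iff .
qed

lemma tensor_X_op:
  fixes a :: "'a ^ 'n::finite"
  shows "tensor_op (\<lambda>i. X_op (a $ i)) $ y $ x = (if y = x + a then 1 else 0)"
proof (cases "y = x + a")
  case False
  then obtain i where "y $ i \<noteq> x $ i + a $ i"
    by (auto simp: vec_eq_iff)
  then show ?thesis
    using False by (auto simp: tensor_op_def X_op_def intro!: prod_zero)
qed (simp add: tensor_op_def X_op_def)

lemma tensor_Z_op: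
  fixes b :: "'a ^ 'n::finite"
  shows "tensor_op (\<lambda>i. Z_op (b $ i)) $ y $ x = (if y = x then additive_char (dot b x) else 0)"
proof (cases "y = x")
  case False
  then obtain i where "y $ i \<noteq> x $ i"
    by (auto simp: vec_eq_iff)
  then show ?thesis
    using False by (auto simp: tensor_op_def Z_op_def intro!: prod_zero)
next
  case True
  then show ?thesis
    by (simp add: tensor_op_def Z_op_def dot_def additive_char_sum flip: additive_char_def)
qed

lemma error_op_entry:
  fixes a b :: "'a ^ 'n::finite"
  shows "error_op c a b $ y $ x =
    (if y = x + a then zeta TYPE('a) ^ c * additive_char (dot b x) else 0)"
proof -
  have "(tensor_op (\<lambda>i. X_op (a $ i)) ** tensor_op (\<lambda>i. Z_op (b $ i))) $ y $ x =
      (\<Sum>z\<in>UNIV. (if y = z + a then 1 else 0) * (if z = x then additive_char (dot b x) else 0))"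
    unfolding matrix_matrix_mult_def by (simp add: tensor_X_op tensor_Z_op)
  also have "\<dots> = (if y = x + a then additive_char (dot b x) else 0)"
    by (subst sum.remove[of _ x]) (auto intro!: sum.neutral)
  finally show ?thesis
    by (simp add: error_op_def scale_op_def map_matrix_def)
qed

text \<open>The phase is taken at \<open>y - a\<close> because the \<open>Z\<close> factor acts
  before the shift.\<close>

lemma error_op_apply:
  fixes a b :: "'a ^ 'n::finite"
  shows "(error_op c a b *v w) $ y =
    zeta TYPE('a) ^ c * additive_char (dot b (y - a)) * w $ (y - a)"
proof -
  have "(error_op c a b *v w) $ y = (\<Sum>x\<in>UNIV. if x = y - a
      then zeta TYPE('a) ^ c * additive_char (dot b x) * w $ x else 0)"
    unfolding matrix_vector_mult_def vec_lambda_beta error_op_entry by (intro sum.cong) auto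
  then show ?thesis
    by simp
qed

lemma error_op_zero: "error_op 0 0 (0 :: 'a ^ 'n::finite) = mat 1"
  by (simp add: matrix_eq vec_eq_iff error_op_apply additive_char_0[OF CARD_eq])

end

section \<open>The stabilizer code of a self-orthogonal code\<close>

lemma hermitian_inner_simps:
  "hermitian_inner u (v - w) = hermitian_inner u v - hermitian_inner u w"
  by (simp add: hermitian_inner_def algebra_simps sum_subtractf)

lemma hermitian_inner_self_eq_0: "hermitian_inner v v = 0 \<longleftrightarrow> v = 0"
proof -
  have "hermitian_inner v v = of_real (\<Sum>i\<in>UNIV. (cmod (v $ i))\<^sup>2)"
    unfolding hermitian_inner_def of_real_sum complex_norm_square by (simp add: mult.commute)
  then show ?thesis
    by (simp only: of_real_eq_0_iff) (simp add: sum_nonneg_eq_0_iff vec_eq_iff)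
qed

text \<open>The residual \<open>w - P *v w\<close> lies in \<open>Q\<close> and is orthogonal to
  \<open>Q\<close>, hence to itself. The argument covers every \<open>P\<close>, as
  \<open>detectable\<close> leaves the projector existentially quantified.\<close>

lemma orthogonal_projector_fixes:
  assumes P: "is_orthogonal_projector P Q" and Q: "vec.subspace Q" and w: "w \<in> Q"
  shows "P *v w = w"
proof -
  have "w - P *v w \<in> Q"
    using P Q w by (simp add: is_orthogonal_projector_def vec.subspace_diff)
  then have "hermitian_inner (w - P *v w) (w - P *v w) = 0"
    using P by (auto simp: is_orthogonal_projector_def)
  then show ?thesis
    by (simp add: hermitian_inner_self_eq_0)
qed

lemma scale_op_apply: "scale_op k P *v w = k *s (P *v w)"
  by (simp add: vec_eq_iff scale_op_def map_matrix_def matrix_vector_mult_def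
      sum_distrib_left mult.assoc)

text \<open>The CSS construction with the same classical code for the \<open>X\<close> part and the
  \<open>Z\<close> part. The dimension \<open>r\<close> is recorded by counting, and
  \<open>dim_less\<close> makes the inclusion in the dual strict.\<close>

locale self_orthogonal_code =
  fixes C :: "('a::{field,finite} ^ 'n::finite) set" and e r :: nat
  assumes CARD_eq: "CARD('a) = CHAR('a) ^ e"
    and subspace: "vec.subspace C"
    and self_orthogonal: "C \<subseteq> euclidean_dual C"
    and card_code: "card C = CARD('a) ^ r"
    and dim_less: "2 * r < CARD('n)"
begin

abbreviation "D \<equiv> euclidean_dual C"

lemmas C_closed = vec.subspace_0[OF subspace] vec.subspace_add[OF subspace]
  vec.subspace_diff[OF subspace] vec.subspace_neg[OF subspace]
lemmas D_closed = vec.subspace_0[OF subspace_euclidean_dual, of C]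
  vec.subspace_add[OF subspace_euclidean_dual, of _ C]
  vec.subspace_diff[OF subspace_euclidean_dual, of _ C]
lemmas char_add = additive_char_add[OF CARD_eq]
lemmas char_0 = additive_char_0[OF CARD_eq]
lemmas apply_error = error_op_apply[OF CARD_eq]

lemma C_imp_D: "x \<in> C \<Longrightarrow> x \<in> D"
  using self_orthogonal by blast

lemma dot_code: "x \<in> C \<Longrightarrow> y \<in> D \<Longrightarrow> dot x y = 0" "x \<in> C \<Longrightarrow> y \<in> D \<Longrightarrow> dot y x = 0"
  by (simp_all add: in_euclidean_dual_iff dot_commute)

lemma D_add_iff:
  assumes "c \<in> C"
  shows "y + c \<in> D \<longleftrightarrow> y \<in> D" "y - c \<in> D \<longleftrightarrow> y \<in> D"
proof -
  note c = C_imp_D[OF assms]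
  show "y + c \<in> D \<longleftrightarrow> y \<in> D"
    using D_closed(2)[OF _ c, of y] D_closed(3)[OF _ c, of "y + c"] by (metis add_diff_cancel)
  show "y - c \<in> D \<longleftrightarrow> y \<in> D"
    using D_closed(2)[OF _ c, of "y - c"] D_closed(3)[OF _ c, of y] by (metis diff_add_cancel)
qed

lemma card_D: "card D = CARD('a) ^ (CARD('n) - r)"
proof -
  have "CARD('a) ^ r * card D = CARD('a) ^ r * CARD('a) ^ (CARD('n) - r)"
    using card_mult_card_euclidean_dual[OF CARD_eq subspace] dim_less
    by (simp add: card_code flip: power_add)
  then show ?thesis
    by simp
qed

lemma card_C_pos: "card C > 0"
  by (simp add: card_code)

section \<open>The code space and its stabilizer group\<close>

text \<open>The support condition encodes invariance under the \<open>Z\<close> type stabilizers,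
  the shift condition invariance under the \<open>X\<close> type ones.\<close>

definition code_space :: "(complex ^ ('a ^ 'n)) set" where
  "code_space = {w. (\<forall>y. y \<notin> D \<longrightarrow> w $ y = 0) \<and> (\<forall>y. \<forall>x\<in>C. w $ (y + x) = w $ y)}"

definition code_stabilizer :: "('a ^ 'n) operator set" where
  "code_stabilizer = {error_op 0 x z | x z. x \<in> C \<and> z \<in> C}"

lemma subspace_code_space: "vec.subspace code_space"
  by (auto simp: vec.subspace_def code_space_def)

lemma code_space_shift:
  assumes "w \<in> code_space" "x \<in> C"
  shows "w $ (y + x) = w $ y" "w $ (y - x) = w $ y"
proof -
  show *: "w $ (y + x) = w $ y" for y
    using assms by (simp add: code_space_def)
  show "w $ (y - x) = w $ y"
    using *[of "y - x"] by simp
qed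

text \<open>The shift does not change \<open>w\<close>. The phase is trivial on \<open>D\<close>
  because \<open>z\<close> is in \<open>C\<close>, and off \<open>D\<close> the vector
  \<open>w\<close> vanishes.\<close>

lemma error_op_fixes_code_space:
  assumes "w \<in> code_space" "x \<in> C" "z \<in> C"
  shows "error_op c x z *v w = zeta TYPE('a) ^ c *s w"
proof -
  have "additive_char (dot z (y - x)) * w $ y = w $ y" for y
  proof (cases "y \<in> D")
    case True
    then have "dot z (y - x) = 0"
      using assms by (intro dot_code) (auto simp: D_add_iff)
    then show ?thesis
      by (simp only: char_0 mult_1_left)
  qed (use assms(1) in \<open>simp add: code_space_def\<close>)
  then show ?thesis
    using assms by (simp add: vec_eq_iff apply_error code_space_shift mult.assoc del: dot_simps)
qed

text \<open>Moving \<open>Z(z)\<close> past \<open>X(x')\<close> costs the phase of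
  \<open>dot z x'\<close>, which is trivial by self-orthogonality. Hence the exponent of
  \<open>zeta\<close> can stay 0 throughout the stabilizer.\<close>

lemma code_stabilizer_mult:
  assumes "x \<in> C" "z \<in> C" "x' \<in> C" "z' \<in> C"
  shows "error_op 0 x z ** error_op 0 x' z' = error_op 0 (x + x') (z + z')"
proof -
  have "dot z (y - x) = dot z (y - (x + x'))" for y
    using assms by (simp add: dot_code C_imp_D)
  then show ?thesis
    by (simp add: matrix_eq vec_eq_iff apply_error char_add diff_diff_eq mult.assoc
        del: dot_simps(2,4) flip: matrix_vector_mul_assoc)
qed

lemma code_stabilizer_inverse:
  assumes "x \<in> C" "z \<in> C"
  shows "error_op 0 x z ** error_op 0 (- x) (- z) = mat 1"
    "error_op 0 (- x) (- z) ** error_op 0 x z = mat 1"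
  using assms C_closed(4)[of x] C_closed(4)[of z]
  by (simp_all only: code_stabilizer_mult right_minus left_minus error_op_zero[OF CARD_eq])

lemma subgroup_code_stabilizer: "subgroup code_stabilizer error_group"
proof
  show "code_stabilizer \<subseteq> carrier error_group"
    by (auto simp: code_stabilizer_def error_group_def)
  show "E \<otimes>\<^bsub>error_group\<^esub> F \<in> code_stabilizer"
    if EF: "E \<in> code_stabilizer" "F \<in> code_stabilizer" for E F
  proof -
    obtain x z x' z' where "E = error_op 0 x z" "F = error_op 0 x' z'"
      and "x \<in> C" "z \<in> C" "x' \<in> C" "z' \<in> C"
      using EF unfolding code_stabilizer_def by blast
    then have "E ** F = error_op 0 (x + x') (z + z')" "x + x' \<in> C" "z + z' \<in> C"
      by (simp_all only: code_stabilizer_mult C_closed(2))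
    then show ?thesis
      unfolding code_stabilizer_def error_group_def monoid.simps by blast
  qed
  show "\<one>\<^bsub>error_group\<^esub> \<in> code_stabilizer"
    using C_closed(1) error_op_zero[OF CARD_eq, where 'n='n]
    unfolding code_stabilizer_def error_group_def monoid.simps by (metis (mono_tags, lifting) mem_Collect_eq)
  show "inv\<^bsub>error_group\<^esub> E \<in> code_stabilizer" if "E \<in> code_stabilizer" for E
  proof -
    obtain x z where E: "E = error_op 0 x z" and xz: "x \<in> C" "z \<in> C"
      using \<open>E \<in> code_stabilizer\<close> unfolding code_stabilizer_def by blast
    let ?F = "error_op 0 (- x) (- z)"
    note F = code_stabilizer_inverse[OF xz, folded E]
    \<comment> \<open>The group inverse is a definite description; a left inverse \<open>G\<close>
      of \<open>E\<close> equals \<open>?F\<close> by associativity of the matrix product.\<close>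
    have "inv\<^bsub>error_group\<^esub> E = ?F"
      unfolding m_inv_def
    proof (rule the_equality)
      show "?F \<in> carrier error_group \<and> E \<otimes>\<^bsub>error_group\<^esub> ?F = \<one>\<^bsub>error_group\<^esub> \<and>
        ?F \<otimes>\<^bsub>error_group\<^esub> E = \<one>\<^bsub>error_group\<^esub>"
        using F unfolding error_group_def partial_object.simps monoid.simps by blast
      fix G assume "G \<in> carrier error_group \<and> E \<otimes>\<^bsub>error_group\<^esub> G = \<one>\<^bsub>error_group\<^esub> \<and>
        G \<otimes>\<^bsub>error_group\<^esub> E = \<one>\<^bsub>error_group\<^esub>"
      then have "G ** E = mat 1"
        unfolding error_group_def monoid.simps by blast
      then show "G = ?F"
        using F by (metis matrix_mul_assoc matrix_mul_lid matrix_mul_rid)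
    qed
    then show ?thesis
      using xz C_closed(4) unfolding code_stabilizer_def by blast
  qed
qed

text \<open>Conversely to the previous invariance, for \<open>y\<close> outside \<open>D\<close>
  some \<open>Z(z)\<close> has a nontrivial phase at \<open>y\<close>, which forces
  \<open>w $ y = 0\<close>; the pure shifts force constancy on cosets.\<close>

lemma code_space_eq: "code_space = {w. \<forall>E\<in>code_stabilizer. E *v w = w}"
proof (intro equalityI subsetI)
  show "w \<in> {w. \<forall>E\<in>code_stabilizer. E *v w = w}" if "w \<in> code_space" for w
    using error_op_fixes_code_space[OF that, of _ _ 0] by (auto simp: code_stabilizer_def)
  fix w assume "w \<in> {w. \<forall>E\<in>code_stabilizer. E *v w = w}"
  then have *: "error_op 0 x z *v w = w" if "x \<in> C" "z \<in> C" for x z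
    using that by (auto simp: code_stabilizer_def)
  have "w $ y = 0" if "y \<notin> D" for y
  proof -
    obtain z where z: "z \<in> C" "additive_char (dot z y) \<noteq> 1"
      using \<open>y \<notin> D\<close> euclidean_dual_iff_char[OF CARD_eq subspace] by blast
    have "additive_char (dot z y) * w $ y = w $ y"
      using arg_cong[OF *[OF C_closed(1) z(1)], of "\<lambda>w. w $ y"] by (simp add: apply_error)
    then show ?thesis
      using z by simp
  qed
  moreover have "w $ (y + x) = w $ y" if "x \<in> C" for x y
    using arg_cong[OF *[OF that C_closed(1)], of "\<lambda>w. w $ (y + x)"]
    by (simp add: apply_error char_0)
  ultimately show "w \<in> code_space"
    by (simp add: code_space_def)
qed

section \<open>Coset states and the dimension of the code space\<close>

text \<open>The unnormalised superposition of the kets in \<open>y + C\<close>. It depends only on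
  the coset, so the image of \<open>D\<close> is a copy of the quotient of \<open>D\<close> by
  \<open>C\<close>.\<close>

definition coset_state :: "'a ^ 'n \<Rightarrow> complex ^ ('a ^ 'n)" where
  "coset_state y = (\<chi> x. if x - y \<in> C then 1 else 0)"

lemma coset_state_in_code_space:
  assumes "y \<in> D"
  shows "coset_state y \<in> code_space"
proof -
  have "x \<in> D" if "x - y \<in> C" for x
    using D_closed(2)[OF C_imp_D[OF that] assms] by simp
  moreover have "x + c - y \<in> C \<longleftrightarrow> x - y \<in> C" if "c \<in> C" for x c
    using C_closed(2)[OF _ that, of "x - y"] C_closed(3)[OF _ that, of "x + c - y"]
    by (auto simp: algebra_simps)
  ultimately show ?thesis
    by (auto simp: code_space_def coset_state_def)
qed

lemma coset_state_eq_iff: "coset_state x = coset_state y \<longleftrightarrow> x - y \<in> C"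
proof
  assume "coset_state x = coset_state y"
  then have "coset_state x $ x = coset_state y $ x"
    by simp
  then show "x - y \<in> C"
    using C_closed(1) by (simp add: coset_state_def split: if_splits)
next
  assume xy: "x - y \<in> C"
  have "z - x \<in> C \<longleftrightarrow> z - y \<in> C" for z
    using C_closed(2)[OF _ xy, of "z - x"] C_closed(3)[OF _ xy, of "z - y"] by auto
  then show "coset_state x = coset_state y"
    by (simp add: coset_state_def vec_eq_iff)
qed

text \<open>Distinct cosets are disjoint. Expressing the entry by equality of states lets a sum over
  states collapse to one term.\<close>

lemma coset_state_apply: "coset_state y $ x = (if coset_state y = coset_state x then 1 else 0)"
  using C_closed(4)[of "x - y"] C_closed(4)[of "y - x"]
  by (auto simp: coset_state_eq_iff) (auto simp: coset_state_def)

text \<open>Each fibre of \<open>coset_state\<close> on \<open>D\<close> is a translate of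
  \<open>C\<close>.\<close>

lemma card_coset_states: "card (coset_state ` D) * card C = card D"
proof -
  have "card D = (\<Sum>b\<in>coset_state ` D. card {y \<in> D. coset_state y = b})"
    using sum.image_gen[of D "\<lambda>_. 1::nat" coset_state] by simp
  also have "\<dots> = (\<Sum>b\<in>coset_state ` D. card C)"
  proof (intro sum.cong refl)
    fix b assume "b \<in> coset_state ` D"
    then obtain y where y: "y \<in> D" "b = coset_state y"
      by blast
    have "{x \<in> D. coset_state x = b} = (+) y ` C"
    proof (intro equalityI subsetI)
      fix x assume "x \<in> {x \<in> D. coset_state x = b}"
      then show "x \<in> (+) y ` C"
        using y by (intro image_eqI[of _ _ "x - y"]) (auto simp: coset_state_eq_iff)
    qed (use y D_add_iff in \<open>auto simp: coset_state_eq_iff\<close>)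
    then show "card {x \<in> D. coset_state x = b} = card C"
      by (simp add: card_image)
  qed
  finally show ?thesis
    by simp
qed

text \<open>The supports are disjoint, so the component at \<open>y\<close> of a linear combination
  is the coefficient of \<open>coset_state y\<close>.\<close>

lemma independent_coset_states: "vec.independent (coset_state ` D)"
proof -
  have "u (coset_state y) = 0"
    if y: "y \<in> D" and 0: "(\<Sum>b\<in>coset_state ` D. u b *s b) = 0" for u y
  proof -
    have "0 = (\<Sum>b\<in>coset_state ` D. u b * b $ y)"
      using arg_cong[OF 0, of "\<lambda>w. w $ y"] by simp
    also have "\<dots> = (\<Sum>b\<in>coset_state ` D. if b = coset_state y then u b else 0)"
      by (intro sum.cong refl) (auto simp: coset_state_apply[of _ y])
    also have "\<dots> = u (coset_state y)"
      using y by simp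
    finally show ?thesis
      by simp
  qed
  then show ?thesis
    by (subst vec.dependent_finite) auto
qed

lemma code_space_subset_span: "code_space \<subseteq> vec.span (coset_state ` D)"
proof
  fix w assume w: "w \<in> code_space"
  \<comment> \<open>A chosen representative of each coset supplies the coefficient; the choice is
    harmless because \<open>w\<close> is constant on cosets.\<close>
  define rep where "rep b = (SOME y. y \<in> D \<and> coset_state y = b)" for b
  have rep: "coset_state (rep (coset_state y)) = coset_state y" if "y \<in> D" for y
    unfolding rep_def using someI_ex[of "\<lambda>x. x \<in> D \<and> coset_state x = coset_state y"] that by blast
  have "w = (\<Sum>b\<in>coset_state ` D. w $ rep b *s b)"
    unfolding vec_eq_iff
  proof
    fix y
    have "(\<Sum>b\<in>coset_state ` D. w $ rep b *s b) $ y =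
        (\<Sum>b\<in>coset_state ` D. if b = coset_state y then w $ rep b else 0)"
      unfolding sum_component by (intro sum.cong refl) (auto simp: coset_state_apply[of _ y])
    also have "\<dots> = w $ y"
    proof (cases "y \<in> D")
      case True
      have "w $ rep (coset_state y) = w $ y"
        using code_space_shift(1)[OF w, of "rep (coset_state y) - y" y] rep[OF True]
        by (simp add: coset_state_eq_iff)
      then show ?thesis
        using True by simp
    next
      case False
      \<comment> \<open>Since \<open>C\<close> lies in \<open>D\<close>, a coset of \<open>C\<close>
        that meets \<open>D\<close> is contained in it.\<close>
      then have "coset_state y \<notin> coset_state ` D"
        by (auto simp: coset_state_eq_iff) (metis D_add_iff(1) add.commute diff_add_cancel)
      then show ?thesis
        using w False by (auto simp: code_space_def)
    qed
    finally show "w $ y = (\<Sum>b\<in>coset_state ` D. w $ rep b *s b) $ y" ..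
  qed
  also have "\<dots> \<in> vec.span (coset_state ` D)"
    by (intro vec.span_sum vec.span_scale vec.span_base)
  finally show "w \<in> vec.span (coset_state ` D)" .
qed

lemma dim_code_space: "vec.dim code_space = CARD('a) ^ (CARD('n) - 2 * r)"
proof -
  have "vec.dim code_space = card (coset_state ` D)"
    using coset_state_in_code_space
    by (intro vec.dim_unique[OF _ code_space_subset_span independent_coset_states refl]) blast
  moreover have "card (coset_state ` D) * CARD('a) ^ r = CARD('a) ^ (CARD('n) - 2 * r) * CARD('a) ^ r"
    using card_coset_states dim_less by (simp add: card_D card_code flip: power_add)
  ultimately show ?thesis
    by simp
qed

lemma is_stabilizer_code_code_space: "is_stabilizer_code code_space"
  unfolding is_stabilizer_code_def
proof (intro exI[of _ code_stabilizer] conjI ballI)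
  show "E ** F = F ** E" if EF: "E \<in> code_stabilizer" "F \<in> code_stabilizer" for E F
  proof -
    obtain x z x' z' where "E = error_op 0 x z" "F = error_op 0 x' z'"
      and "x \<in> C" "z \<in> C" "x' \<in> C" "z' \<in> C"
      using EF unfolding code_stabilizer_def by blast
    then show ?thesis
      by (simp only: code_stabilizer_mult add.commute)
  qed
  show "code_space \<noteq> {0}"
  proof
    assume "code_space = {0}"
    then have "vec.dim code_space = 0"
      by (simp only: vec.dim_singleton simp_thms if_True)
    then show False
      by (simp add: dim_code_space)
  qed
qed (rule subgroup_code_stabilizer code_space_eq)+

section \<open>The projector and the detectable errors\<close>

text \<open>Average over the cosets of \<open>C\<close>, keeping only those inside
  \<open>D\<close>.\<close>

definition code_projector :: "('a ^ 'n) operator" where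
  "code_projector = (\<chi> y x. if y \<in> D \<and> x - y \<in> C then 1 / of_nat (card C) else 0)"

lemma code_projector_apply:
  "(code_projector *v w) $ y = (if y \<in> D then (\<Sum>x\<in>C. w $ (y + x)) / of_nat (card C) else 0)"
proof -
  have "(code_projector *v w) $ y =
      (\<Sum>x\<in>UNIV. if y \<in> D \<and> x - y \<in> C then w $ x / of_nat (card C) else 0)"
    by (auto simp: code_projector_def matrix_vector_mult_def intro!: sum.cong)
  also have "\<dots> = (\<Sum>x\<in>UNIV. if y \<in> D \<and> x \<in> C then w $ (y + x) / of_nat (card C) else 0)"
    by (rule sum.reindex_bij_witness[of _ "\<lambda>x. y + x" "\<lambda>x. x - y"]) auto
  also have "\<dots> = (if y \<in> D then (\<Sum>x\<in>C. w $ (y + x)) / of_nat (card C) else 0)"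
    by (simp add: sum.If_cases sum_divide_distrib)
  finally show ?thesis .
qed

lemma sum_shift_C:
  assumes "x \<in> C"
  shows "(\<Sum>x'\<in>C. h (y + x + x')) = (\<Sum>x'\<in>C. h (y + x'))"
  using assms C_closed(2,3)
  by (intro sum.reindex_bij_witness[of _ "\<lambda>x'. x' - x" "\<lambda>x'. x' + x"]) (auto simp: algebra_simps)

lemma is_orthogonal_projector_code_projector: "is_orthogonal_projector code_projector code_space"
  unfolding is_orthogonal_projector_def
proof (intro allI conjI ballI)
  fix v
  show "code_projector *v v \<in> code_space"
    using sum_shift_C[of _ "\<lambda>x. v $ x"]
    by (simp add: code_space_def code_projector_apply D_add_iff)
  fix w assume w: "w \<in> code_space"
  \<comment> \<open>Reindexing by a codeword moves \<open>v\<close> but leaves \<open>w\<close>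
    unchanged, so each term of the average contributes the same inner product.\<close>
  have shift: "(\<Sum>y\<in>UNIV. cnj (w $ y) * v $ (y + x)) = hermitian_inner w v" if "x \<in> C" for x
    unfolding hermitian_inner_def using that code_space_shift[OF w that]
    by (intro sum.reindex_bij_witness[of _ "\<lambda>y. y - x" "\<lambda>y. y + x"]) auto
  have "cnj (w $ y) * (code_projector *v v) $ y =
      (\<Sum>x\<in>C. cnj (w $ y) * v $ (y + x)) / of_nat (card C)" for y
    using w by (simp add: code_projector_apply code_space_def sum_distrib_left)
  then have "hermitian_inner w (code_projector *v v) =
      (\<Sum>y\<in>UNIV. \<Sum>x\<in>C. cnj (w $ y) * v $ (y + x)) / of_nat (card C)"
    by (simp add: hermitian_inner_def sum_divide_distrib)
  also have "\<dots> = hermitian_inner w v"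
    using card_C_pos C_closed(1) by (subst sum.swap) (auto simp: shift)
  finally show "hermitian_inner w (v - code_projector *v v) = 0"
    by (simp add: hermitian_inner_simps)
qed

text \<open>If \<open>x\<close> is outside \<open>D\<close>, the shift moves the support off
  \<open>D\<close>. Otherwise \<open>z\<close> is outside \<open>D\<close>, and averaging over a
  coset produces a vanishing character sum.\<close>

lemma code_projector_error_op:
  assumes "w \<in> code_space" "x \<notin> D \<or> z \<notin> D"
  shows "code_projector *v (error_op c x z *v w) = 0"
proof -
  have "(\<Sum>x'\<in>C. (error_op c x z *v w) $ (y + x')) = 0" if "y \<in> D" for y
  proof (cases "x \<in> D")
    case False
    have "y + x' - x \<notin> D" if "x' \<in> C" for x'
      using False D_closed(3)[of "y + x'" "y + x' - x"] that \<open>y \<in> D\<close> by (auto simp: D_add_iff)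
    then show ?thesis
      using assms(1) by (simp add: apply_error code_space_def)
  next
    case True
    have "(error_op c x z *v w) $ (y + x') =
        (error_op c x z *v w) $ y * additive_char (dot x' z)" if "x' \<in> C" for x'
    proof -
      have "w $ (y + x' - x) = w $ (y - x)"
        using code_space_shift(1)[OF assms(1) that, of "y - x"] by (simp add: algebra_simps)
      moreover have "dot z (y + x' - x) = dot z (y - x) + dot x' z"
        by (simp add: dot_commute)
      ultimately show ?thesis
        by (simp add: apply_error char_add del: dot_simps)
    qed
    then have "(\<Sum>x'\<in>C. (error_op c x z *v w) $ (y + x')) =
        (error_op c x z *v w) $ y * (\<Sum>x'\<in>C. additive_char (dot x' z))"
      by (simp add: sum_distrib_left)
    then show ?thesis
      using True assms(2) by (simp add: sum_additive_char_subspace[OF CARD_eq subspace])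
  qed
  then show ?thesis
    by (simp add: vec_eq_iff code_projector_apply)
qed

text \<open>With both parts in \<open>C\<close> the error acts on the code as the scalar
  \<open>zeta ^ c\<close>; with a part outside \<open>D\<close> the projector annihilates its image,
  and the scalar is 0.\<close>

lemma detectable_code_space:
  assumes "(x \<in> C \<and> z \<in> C) \<or> x \<notin> D \<or> z \<notin> D"
  shows "detectable code_space (error_op c x z)"
proof -
  let ?P = code_projector
  let ?k = "if x \<in> C \<and> z \<in> C then zeta TYPE('a) ^ c else 0"
  have "?P *v (error_op c x z *v (?P *v w)) = ?k *s (?P *v w)" for w
  proof -
    have P: "?P *v w \<in> code_space"
      using is_orthogonal_projector_code_projector by (simp add: is_orthogonal_projector_def)
    show ?thesis
    proof (cases "x \<in> C \<and> z \<in> C")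
      case True
      then have "?P *v (error_op c x z *v (?P *v w)) = zeta TYPE('a) ^ c *s (?P *v (?P *v w))"
        by (simp add: error_op_fixes_code_space[OF P] vec.scale)
      then show ?thesis
        using True orthogonal_projector_fixes[OF is_orthogonal_projector_code_projector
            subspace_code_space P] by simp
    next
      case False
      then show ?thesis
        using code_projector_error_op[OF P] assms by auto
    qed
  qed
  then have "?P ** error_op c x z ** ?P = scale_op ?k ?P"
    by (simp add: matrix_eq scale_op_apply flip: matrix_vector_mul_assoc)
  then show ?thesis
    using is_orthogonal_projector_code_projector by (auto simp: detectable_def)
qed

lemma X_error_apply: "error_op 0 x 0 *v coset_state 0 = coset_state x"
  by (simp add: vec_eq_iff apply_error coset_state_def char_0)

text \<open>The shift carries the coset state of \<open>C\<close> to that of another coset inside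
  \<open>D\<close>. Both are fixed by any projector onto the code, yet their supports are disjoint,
  so neither is a multiple of the other.\<close>

lemma not_detectable_code_space:
  assumes "x \<in> D" "x \<notin> C"
  shows "\<not> detectable code_space (error_op 0 x 0)"
proof
  assume "detectable code_space (error_op 0 x 0)"
  then obtain P k where P: "is_orthogonal_projector P code_space"
    and PEP: "P ** error_op 0 x 0 ** P = scale_op k P"
    by (auto simp: detectable_def)
  note fixes_code = orthogonal_projector_fixes[OF P subspace_code_space coset_state_in_code_space]
  have "(P ** error_op 0 x 0 ** P) *v coset_state 0 = coset_state x"
    using assms(1) by (simp add: fixes_code D_closed(1) X_error_apply flip: matrix_vector_mul_assoc)
  then have "coset_state x = k *s coset_state 0"
    unfolding PEP by (simp add: scale_op_apply fixes_code D_closed(1))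
  then have "coset_state x $ x = k * coset_state 0 $ x"
    by simp
  then show False
    using assms(2) C_closed(1) by (simp add: coset_state_def)
qed

text \<open>An error not covered by \<open>detectable_code_space\<close> has a part in
  \<open>D - C\<close>, whose weight bounds that of the error from below. The bound is attained by a
  pure shift along a vector of minimum weight.\<close>

lemma stabilizer_code_params_code_space:
  "stabilizer_code_params code_space CARD('n) (CARD('n) - 2 * r) (min_weight (D - C))"
proof -
  let ?d = "min_weight (D - C)"
  have "1 < CARD('a)"
    using card_mono[of UNIV "{0, 1 :: 'a}"] by simp
  \<comment> \<open>Strictness makes \<open>D - C\<close> nonempty, so that the minimum defining
    \<open>?d\<close> is attained.\<close>
  then have "card C < card D"
    using dim_less unfolding card_D card_code by (intro power_strict_increasing) simp_all
  then have "\<not> D \<subseteq> C"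
    using card_mono[of C D] by (metis finite leD)
  moreover have "0 \<notin> D - C"
    using C_closed(1) by blast
  ultimately have ne: "D - C - {0} \<noteq> {}" and eq: "D - C - {0} = D - C"
    by blast+
  have min_le: "?d \<le> hamming_weight x" if "x \<in> D" "x \<notin> C" for x
    unfolding min_weight_def eq using that by (intro Min_le finite_imageI finite imageI DiffI)
  have "?d \<in> hamming_weight ` (D - C)"
    using ne unfolding min_weight_def eq
    by (intro Min_in finite_imageI finite) (simp only: image_is_empty not_False_eq_True)
  then obtain x where x: "x \<in> D" "x \<notin> C" "hamming_weight x = ?d"
    by (elim imageE DiffE) simp
  have "detectable code_space (error_op c a b)" if "error_weight a b < ?d" for c a b
  proof (rule detectable_code_space)
    have "hamming_weight a \<le> error_weight a b" "hamming_weight b \<le> error_weight a b"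
      unfolding hamming_weight_def error_weight_def by (intro card_mono finite; blast)+
    then have "\<not> ?d \<le> hamming_weight a" "\<not> ?d \<le> hamming_weight b"
      using that by linarith+
    then show "(a \<in> C \<and> b \<in> C) \<or> a \<notin> D \<or> b \<notin> D"
      using min_le by blast
  qed
  then have "detects_below code_space ?d"
    unfolding detects_below_def by blast
  moreover have "d' \<le> ?d" if "detects_below code_space d'" for d'
  proof (rule ccontr)
    assume "\<not> d' \<le> ?d"
    moreover have "error_weight x 0 = hamming_weight x"
      unfolding error_weight_def hamming_weight_def by simp
    ultimately have "error_weight x 0 < d'"
      using x(3) by linarith
    then show False
      using that not_detectable_code_space[OF x(1,2)] unfolding detects_below_def by blast
  qed
  ultimately show ?thesis
    unfolding stabilizer_code_params_def has_min_distance_def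
    using is_stabilizer_code_code_space dim_code_space by blast
qed

end

section \<open>The twisted code\<close>

text \<open>In the product rule every summand except the one differentiating the factor of
  \<open>i\<close> still contains that factor and vanishes at its root.\<close>

lemma poly_pderiv_prod_linear_root:
  fixes \<alpha> :: "'i \<Rightarrow> 'a::field"
  assumes "finite I" "i \<in> I"
  shows "poly (pderiv (\<Prod>j\<in>I. [:- \<alpha> j, 1:])) (\<alpha> i) = (\<Prod>j\<in>I - {i}. \<alpha> i - \<alpha> j)"
proof -
  have "poly (\<Prod>j\<in>I - {k}. [:- \<alpha> j, 1:]) (\<alpha> i) = 0" if "k \<in> I - {i}" for k
    using assms that unfolding poly_prod by (intro prod_zero) auto
  moreover have "pderiv [:- \<alpha> k, 1:] = 1" for k
    by (simp add: pderiv_pCons)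
  ultimately have "poly (pderiv (\<Prod>j\<in>I. [:- \<alpha> j, 1:])) (\<alpha> i) =
      poly (\<Prod>j\<in>I - {i}. [:- \<alpha> j, 1:]) (\<alpha> i)"
    unfolding pderiv_prod poly_sum by (subst sum.remove[OF assms]) simp
  then show ?thesis
    by (simp add: poly_prod)
qed

text \<open>Lagrange interpolation, compared in the coefficient of degree \<open>card I - 1\<close>.\<close>

lemma sum_poly_over_node_products:
  fixes \<alpha> :: "'i \<Rightarrow> 'a::field"
  assumes fin: "finite I" and inj: "inj_on \<alpha> I" and deg: "Polynomial.degree F < card I"
  shows "(\<Sum>i\<in>I. poly F (\<alpha> i) / (\<Prod>j\<in>I - {i}. \<alpha> i - \<alpha> j)) = Polynomial.coeff F (card I - 1)"
proof -
  \<comment> \<open>Dividing \<open>L i\<close> by \<open>d i\<close> gives the Lagrange basis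
    polynomial of the node \<open>\<alpha> i\<close>, and \<open>G\<close> is the interpolant of
    \<open>F\<close>.\<close>
  define L where "L i = (\<Prod>j\<in>I - {i}. [:- \<alpha> j, 1:])" for i
  define d where "d i = (\<Prod>j\<in>I - {i}. \<alpha> i - \<alpha> j)" for i
  define G where "G = (\<Sum>i\<in>I. Polynomial.smult (poly F (\<alpha> i) / d i) (L i))"
  have degL: "Polynomial.degree (L i) = card I - 1" if "i \<in> I" for i
    unfolding L_def using that fin by (subst degree_prod_eq_sum_degree) auto
  have "lead_coeff (L i) = 1" for i
    unfolding L_def lead_coeff_prod by simp
  then have coeffL: "Polynomial.coeff (L i) (card I - 1) = 1" if "i \<in> I" for i
    using degL[OF that] by metis
  have polyL: "poly (L i) (\<alpha> k) = (if i = k then d i else 0)" if "i \<in> I" "k \<in> I" for i k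
  proof (cases "i = k")
    case False
    then show ?thesis
      using that fin unfolding L_def poly_prod by (auto intro!: prod_zero)
  qed (simp add: L_def d_def poly_prod)
  have d_nz: "d i \<noteq> 0" if "i \<in> I" for i
    using fin inj that by (auto simp: d_def inj_on_def)
  have "F = G"
  proof (rule poly_eqI_degree[of "\<alpha> ` I"])
    have "Polynomial.degree G \<le> card I - 1"
      unfolding G_def using degL by (intro degree_sum_le fin) simp
    \<comment> \<open>The bound on \<open>F\<close> also makes \<open>I\<close> nonempty, so
      \<open>card I - 1\<close> is strictly below \<open>card I\<close>.\<close>
    then show "Polynomial.degree G < card (\<alpha> ` I)"
      using deg by (simp add: card_image[OF inj])
    show "Polynomial.degree F < card (\<alpha> ` I)"
      using deg by (simp add: card_image[OF inj])
    fix x assume "x \<in> \<alpha> ` I"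
    then obtain k where k: "k \<in> I" "x = \<alpha> k"
      by blast
    have "poly G x = (\<Sum>i\<in>I. if i = k then poly F (\<alpha> i) else 0)"
      unfolding G_def poly_sum using k polyL d_nz by (intro sum.cong) auto
    then show "poly F x = poly G x"
      using k fin by simp
  qed
  then have "Polynomial.coeff F (card I - 1) =
      (\<Sum>i\<in>I. poly F (\<alpha> i) / d i * Polynomial.coeff (L i) (card I - 1))"
    using coeff_sum[of "\<lambda>i. Polynomial.smult (poly F (\<alpha> i) / d i) (L i)" I "card I - 1"]
    by (simp only: G_def coeff_smult)
  also have "\<dots> = (\<Sum>i\<in>I. poly F (\<alpha> i) / d i)"
    by (intro sum.cong refl) (simp only: coeffL mult_1_right)
  finally show ?thesis
    by (simp add: d_def)
qed

section \<open>Self-orthogonality of the twisted code\<close>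

text \<open>Inner products of evaluation vectors involve the multipliers only through their squares,
  so these are what is tied to the derivative of \<open>g\<close>.\<close>

locale twisted_code =
  fixes m :: nat and a b c \<beta> \<eta> :: "'a::{field,finite}" and \<alpha> v :: "'a ^ 'n::finite" and g :: "'a poly"
  assumes char_2: "CHAR('a) = 2"
    and m_pos: "m > 0"
    and card_n: "CARD('n) = 2 * m + 1"
    and g_def: "g = Polynomial.monom 1 (2 * m + 1) + Polynomial.monom a (2 * m)
      + Polynomial.monom b (2 * m - 1) + Polynomial.monom c 0"
    and inj_\<alpha>: "inj (\<lambda>i. \<alpha> $ i)"
    and root: "\<And>i. poly g (\<alpha> $ i) = 0"
    and \<beta>: "\<beta>\<^sup>2 = b + a\<^sup>2"
    and v: "\<And>i. (v $ i)\<^sup>2 = inverse (poly (pderiv g) (\<alpha> $ i))"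
begin

lemma two_eq_0: "(2 :: 'a) = 0"
  using of_nat_CHAR[where 'a='a] by (simp add: char_2)

text \<open>Both sides are monic of degree \<open>2 * m + 1\<close> and agree at that many distinct
  points.\<close>

lemma g_eq_prod: "g = (\<Prod>i\<in>UNIV. [:- (\<alpha> $ i), 1:])"
proof (rule poly_eqI_degree_lead_coeff[of _ "2 * m + 1" _ "range (\<lambda>i. \<alpha> $ i)"])
  let ?p = "\<Prod>i\<in>(UNIV::'n set). [:- (\<alpha> $ i), 1:]"
  have deg: "Polynomial.degree ?p = 2 * m + 1"
    by (subst degree_prod_eq_sum_degree) (auto simp: card_n)
  moreover have "lead_coeff ?p = 1"
    unfolding lead_coeff_prod by simp
  ultimately have "Polynomial.coeff ?p (2 * m + 1) = 1"
    by metis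
  then show "Polynomial.coeff g (2 * m + 1) = Polynomial.coeff ?p (2 * m + 1)"
    by (simp add: g_def)
  show "Polynomial.degree ?p \<le> 2 * m + 1"
    using deg by simp
  show "Polynomial.degree g \<le> 2 * m + 1"
    unfolding g_def by (intro degree_add_le order.trans[OF degree_monom_le]) auto
  show "2 * m + 1 \<le> card (range (\<lambda>i. \<alpha> $ i))"
    by (simp add: card_image[OF inj_\<alpha>] card_n)
  show "poly g z = poly ?p z" if "z \<in> range (\<lambda>i. \<alpha> $ i)" for z
    using that root by (auto simp: poly_prod intro!: prod_zero[symmetric])
qed

lemma pderiv_g_root: "poly (pderiv g) (\<alpha> $ i) = (\<Prod>j\<in>UNIV - {i}. \<alpha> $ i - \<alpha> $ j)"
  unfolding g_eq_prod using poly_pderiv_prod_linear_root[of UNIV i "\<lambda>i. \<alpha> $ i"] by simp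

text \<open>Distinct roots keep the derivative nonzero at each of them. Evaluation vectors therefore
  determine the values of the polynomial at the nodes.\<close>

lemma v_nonzero: "v $ i \<noteq> 0"
proof -
  have "poly (pderiv g) (\<alpha> $ i) \<noteq> 0"
    using inj_\<alpha> by (auto simp: pderiv_g_root inj_def)
  then show ?thesis
    using v[of i] by auto
qed

text \<open>The squared multipliers are the barycentric weights of the nodes, and
  \<open>2 * m\<close> is one less than the number of nodes.\<close>

lemma weighted_sum_poly:
  assumes "Polynomial.degree F \<le> 2 * m"
  shows "(\<Sum>i\<in>UNIV. (v $ i)\<^sup>2 * poly F (\<alpha> $ i)) = Polynomial.coeff F (2 * m)"
  using sum_poly_over_node_products[of UNIV "\<lambda>i. \<alpha> $ i" F] inj_\<alpha> assms
  by (simp add: card_n v pderiv_g_root divide_inverse mult.commute)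

text \<open>Splitting an element of the evaluated space into \<open>U f\<close> of degree below
  \<open>m\<close> and a multiple of the fixed twist \<open>W\<close> reduces an inner product to
  four weighted sums.\<close>

definition U :: "(nat \<Rightarrow> 'a) \<Rightarrow> 'a poly" where
  "U f = (\<Sum>i = 0..m - 1. Polynomial.monom (f i) i)"

definition W :: "'a poly" where
  "W = Polynomial.monom \<beta> m + Polynomial.monom 1 (m + 1)"

definition twisted :: "(nat \<Rightarrow> 'a) \<Rightarrow> 'a poly" where
  "twisted f = U f + Polynomial.smult (f (m - 1) * \<eta>) W"

lemma coeff_U: "Polynomial.coeff (U f) j = (if j < m then f j else 0)"
proof -
  have "Polynomial.coeff (U f) j = (\<Sum>i = 0..m - 1. if i = j then f j else 0)"
    unfolding U_def coeff_sum by (intro sum.cong) auto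
  then show ?thesis
    using m_pos by auto
qed

lemma degree_U: "Polynomial.degree (U f) \<le> m - 1"
  by (rule degree_le) (auto simp: coeff_U)

lemma degree_W: "Polynomial.degree W \<le> m + 1"
  unfolding W_def by (intro degree_add_le order.trans[OF degree_monom_le]) auto

lemma degree_twisted: "Polynomial.degree (twisted f) \<le> m + 1"
  unfolding twisted_def using degree_U[of f] degree_W
  by (intro degree_add_le order.trans[OF degree_smult_le]) auto

text \<open>The twist only has terms of degree \<open>m\<close> and \<open>m + 1\<close>, so the
  coefficients of \<open>f\<close> can be read off.\<close>

lemma coeff_twisted: "j < m \<Longrightarrow> Polynomial.coeff (twisted f) j = f j"
  by (simp add: twisted_def coeff_U W_def)

text \<open>The product has degree at most \<open>2 * m - 2\<close>, too low to reach the extracted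
  coefficient.\<close>

lemma weighted_sum_U_U: "(\<Sum>i\<in>UNIV. (v $ i)\<^sup>2 * poly (U f * U f') (\<alpha> $ i)) = 0"
proof -
  have "Polynomial.degree (U f * U f') \<le> 2 * m - 2"
    using degree_mult_le[of "U f" "U f'"] degree_U[of f] degree_U[of f'] by linarith
  then show ?thesis
    using m_pos by (subst weighted_sum_poly) (auto intro: coeff_eq_0)
qed

text \<open>Only the top term of \<open>U f\<close> times \<open>x ^ (m + 1)\<close> reaches degree
  \<open>2 * m\<close>; the \<open>\<beta>\<close> term of \<open>W\<close> stops one degree
  short.\<close>

lemma weighted_sum_U_W: "(\<Sum>i\<in>UNIV. (v $ i)\<^sup>2 * poly (U f * W) (\<alpha> $ i)) = f (m - 1)"
proof -
  have "Polynomial.degree (U f * W) \<le> 2 * m"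
    using degree_mult_le[of "U f" W] degree_U[of f] degree_W m_pos by linarith
  moreover have "Polynomial.coeff (W * U f) (2 * m) = f (m - 1)"
    using m_pos by (simp add: W_def distrib_right coeff_monom_mult coeff_U)
  ultimately show ?thesis
    by (subst weighted_sum_poly) (simp_all add: mult.commute)
qed

text \<open>Modulo \<open>g\<close>, the square of \<open>W\<close> has degree below \<open>2 * m\<close>:
  in \<open>W\<^sup>2 - (x + a) * g\<close> the coefficients of the higher powers are even or equal to
  \<open>\<beta>\<^sup>2 - (b + a\<^sup>2) = 0\<close>.\<close>

lemma weighted_sum_W_W: "(\<Sum>i\<in>UNIV. (v $ i)\<^sup>2 * poly (W * W) (\<alpha> $ i)) = 0"
proof -
  let ?R = "Polynomial.monom (a * b) (2 * m - 1) + Polynomial.monom c 1 + Polynomial.monom (a * c) 0"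
  have W_R: "poly (W * W) (\<alpha> $ i) = poly ?R (\<alpha> $ i)" for i
  proof -
    \<comment> \<open>With \<open>y\<close> for the lowest large power, all powers in the reduction
      are small multiples of \<open>y\<close>, and \<open>m > 0\<close> keeps the truncated exponent
      exact.\<close>
    define x y where "x = \<alpha> $ i" and "y = x ^ (2 * m - 1)"
    have "2 * m = Suc (2 * m - 1)"
      using m_pos by simp
    then have pow: "x ^ (2 * m) = x * y" "x ^ (2 * m + 1) = x\<^sup>2 * y"
      unfolding y_def by (metis power_Suc, metis power_Suc power2_eq_square mult.assoc Suc_eq_plus1)
    have g: "x\<^sup>2 * y + a * (x * y) + b * y + c = 0"
      using root[of i]
      unfolding g_def x_def[symmetric] poly_add poly_monom pow y_def[symmetric] by simp
    have "poly (W * W) x = \<beta>\<^sup>2 * (x ^ m * x ^ m) + 2 * (\<beta> * x * (x ^ m * x ^ m)) + x\<^sup>2 * (x ^ m * x ^ m)"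
      by (simp add: W_def poly_monom algebra_simps power2_eq_square)
    also have "x ^ m * x ^ m = x * y"
      unfolding pow(1)[symmetric] mult_2 power_add ..
    also have "\<beta>\<^sup>2 * (x * y) + 2 * (\<beta> * x * (x * y)) + x\<^sup>2 * (x * y) = (b + a\<^sup>2) * (x * y) + x\<^sup>2 * (x * y)"
      unfolding \<beta> two_eq_0 by simp
    \<comment> \<open>An identity over any commutative ring: the first product vanishes as
      \<open>x\<close> is a root of \<open>g\<close>, and the multiple of 2 vanishes in
      characteristic 2.\<close>
    also have "\<dots> = (x + a) * (x\<^sup>2 * y + a * (x * y) + b * y + c) + (a * b * y + c * x + a * c)
        - 2 * (a * x\<^sup>2 * y + a * b * y + c * x + a * c)"
      by (simp add: algebra_simps power2_eq_square)
    also have "\<dots> = a * b * y + c * x + a * c"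
      unfolding g two_eq_0 by simp
    finally show ?thesis
      by (simp add: poly_monom x_def y_def)
  qed
  have "Polynomial.degree ?R \<le> 2 * m"
    using m_pos by (intro degree_add_le order.trans[OF degree_monom_le]) auto
  then have "(\<Sum>i\<in>UNIV. (v $ i)\<^sup>2 * poly ?R (\<alpha> $ i)) = Polynomial.coeff ?R (2 * m)"
    by (rule weighted_sum_poly)
  also have "\<dots> = 0"
    using m_pos by simp
  finally show ?thesis
    unfolding W_R .
qed

lemma dot_ev_twisted: "dot (ev \<alpha> v (twisted f)) (ev \<alpha> v (twisted f')) = 0"
proof -
  let ?e = "f (m - 1) * \<eta>" and ?e' = "f' (m - 1) * \<eta>"
  let ?S = "\<lambda>F. \<Sum>i\<in>UNIV. (v $ i)\<^sup>2 * poly F (\<alpha> $ i)"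
  have "dot (ev \<alpha> v (twisted f)) (ev \<alpha> v (twisted f')) =
      ?S (U f * U f') + ?e' * ?S (U f * W) + ?e * ?S (U f' * W) + ?e * ?e' * ?S (W * W)"
    unfolding dot_def ev_def twisted_def sum_distrib_left sum.distrib[symmetric]
    by (intro sum.cong) (simp_all add: algebra_simps power2_eq_square)
  \<comment> \<open>Both cross terms equal \<open>f (m - 1) * f' (m - 1) * \<eta>\<close>.\<close>
  also have "\<dots> = 2 * (f (m - 1) * f' (m - 1) * \<eta>)"
    unfolding weighted_sum_U_U weighted_sum_U_W weighted_sum_W_W by (simp add: algebra_simps)
  finally show ?thesis
    by (simp add: two_eq_0)
qed

section \<open>Linearity and size of the twisted code\<close>

text \<open>For \<open>m > 0\<close> the degree bound \<open>m + 1\<close> is below the number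
  \<open>2 * m + 1\<close> of nodes, so equal evaluations force equal polynomials.\<close>

lemma ev_twisted_eq_imp:
  assumes "ev \<alpha> v (twisted f) = ev \<alpha> v (twisted f')" "j < m"
  shows "f j = f' j"
proof -
  have "twisted f = twisted f'"
  proof (rule poly_eqI_degree[of "range (\<lambda>i. \<alpha> $ i)"])
    show "poly (twisted f) x = poly (twisted f') x" if "x \<in> range (\<lambda>i. \<alpha> $ i)" for x
      using that assms(1) v_nonzero by (auto simp: ev_def vec_eq_iff)
  qed (use degree_twisted[of f] degree_twisted[of f'] m_pos in
      \<open>simp_all add: card_image[OF inj_\<alpha>] card_n\<close>)
  then show ?thesis
    using coeff_twisted[OF assms(2)] by metis
qed

lemma twisted_linear:
  "twisted (\<lambda>i. r * f i) = Polynomial.smult r (twisted f)"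
  "twisted (\<lambda>i. f i + f' i) = twisted f + twisted f'"
  by (rule poly_eqI, simp add: twisted_def coeff_U algebra_simps)+

definition code :: "('a ^ 'n) set" where
  "code = range (\<lambda>f. ev \<alpha> v (twisted f))"

lemma subspace_code: "vec.subspace code"
proof -
  have "ev \<alpha> v (F + G) = ev \<alpha> v F + ev \<alpha> v G" "ev \<alpha> v (Polynomial.smult r F) = r *s ev \<alpha> v F"
    for F G r by (simp_all add: ev_def vec_eq_iff algebra_simps)
  note ev_linear = this twisted_linear
  show ?thesis
    unfolding vec.subspace_def
  proof (intro conjI ballI allI)
    have "ev \<alpha> v (twisted (\<lambda>i. 0)) = 0"
      by (simp add: twisted_def U_def ev_def vec_eq_iff)
    then show "0 \<in> code"
      unfolding code_def by (metis rangeI)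
    show "x + y \<in> code" if "x \<in> code" "y \<in> code" for x y
      using that unfolding code_def by (auto simp flip: ev_linear)
    show "r *s x \<in> code" if "x \<in> code" for r x
      using that unfolding code_def by (auto simp flip: ev_linear)
  qed
qed

lemma card_code: "card code = CARD('a) ^ m"
proof -
  \<comment> \<open>Infinitely many functions \<open>f\<close> give the same codeword, since only
    the arguments below \<open>m\<close> matter; extensional functions pick one per
    codeword.\<close>
  let ?F = "PiE {..<m} (\<lambda>_. UNIV :: 'a set)"
  have "twisted f = twisted (restrict f {..<m})" for f
  proof -
    have "U f = U (restrict f {..<m})"
      unfolding U_def using m_pos by (intro sum.cong) auto
    then show ?thesis
      using m_pos by (simp add: twisted_def)
  qed
  then have "ev \<alpha> v (twisted f) \<in> (\<lambda>f. ev \<alpha> v (twisted f)) ` ?F" for f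
    by (rule image_eqI[of _ _ "restrict f {..<m}", OF arg_cong[of _ _ "ev \<alpha> v"]]) simp
  then have "code = (\<lambda>f. ev \<alpha> v (twisted f)) ` ?F"
    unfolding code_def by blast
  moreover have "inj_on (\<lambda>f. ev \<alpha> v (twisted f)) ?F"
    by (intro inj_onI PiE_ext ev_twisted_eq_imp) (auto simp only: lessThan_iff)
  ultimately show ?thesis
    by (simp add: card_image card_PiE)
qed

end

section \<open>Specialisation to the given polynomial and multipliers\<close>

theorem proposition19:
  fixes s h t :: nat
    and k :: "'a::{field,finite} set"
    and a b c \<eta>\<^sub>2 :: 'a
    and g :: "'a poly"
    and \<alpha> v :: "'a ^ 'n::finite"
    and S\<^sub>1 :: "'a poly set"
    and C\<^sub>1 :: "('a ^ 'n) set"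
  assumes "s > 0" "h > 0" "t > 0" "t dvd h" "s < h"
    and "CARD('a) = 2 ^ h"
    and "subfield k ring_of_type_algebra" "card k = 2 ^ t"
    and "a \<in> k" "b \<in> k" "c \<in> k" "b \<noteq> 0" "c \<noteq> 0"
    and "g = Polynomial.monom 1 (2 ^ s + 1) + Polynomial.monom a (2 ^ s)
             + Polynomial.monom b (2 ^ s - 1) + Polynomial.monom c 0"
    and "is_splitting_field k g"
    and "CARD('n) = 2 ^ s + 1"
    and "inj (\<lambda>i. \<alpha> $ i)" "range (\<lambda>i. \<alpha> $ i) = {x. poly g x = 0}"
    and "\<And>i. v $ i = inverse ((\<alpha> $ i) ^ (2 ^ (s - 1))
                              + b ^ (2 ^ (h - 1)) * (\<alpha> $ i) ^ (2 ^ (s - 1) - 1))"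
    and "\<eta>\<^sub>2 \<noteq> 0"
    and "S\<^sub>1 = {(\<Sum>i = 0..2 ^ (s - 1) - 1. Polynomial.monom (f i) i)
                + Polynomial.smult (f (2 ^ (s - 1) - 1) * \<eta>\<^sub>2)
                    (Polynomial.monom (b ^ (2 ^ (h - 1)) + a) (2 ^ (s - 1))
                     + Polynomial.monom 1 (2 ^ (s - 1) + 1))
              | f :: nat \<Rightarrow> 'a. True}"
    and "C\<^sub>1 = ev \<alpha> v ` S\<^sub>1"
  shows "\<exists>Q :: (complex ^ ('a ^ 'n)) set.
           stabilizer_code_params Q (2 ^ s + 1) 1 (min_weight (euclidean_dual C\<^sub>1 - C\<^sub>1))"
proof -
  define m :: nat where "m = 2 ^ (s - 1)"
  define \<gamma> where "\<gamma> = b ^ (2 ^ (h - 1))"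
  note fold_defs = m_def[symmetric] \<gamma>_def[symmetric]
  have m_pos: "m > 0" and s: "2 ^ s = 2 * m"
    using \<open>s > 0\<close> unfolding m_def by (simp_all flip: power_Suc)
  note card = \<open>CARD('a) = 2 ^ h\<close>
  note g = \<open>g = _\<close>[unfolded s]
  have "CHAR('a) dvd 2 ^ h"
    using CHAR_dvd_CARD[where 'a='a] unfolding card .
  then have char_2: "CHAR('a) = 2"
    using CHAR_prime_finite[where 'a='a] by (metis prime_dvd_power primes_dvd_imp_eq two_is_prime_nat)
  then have two: "(2::'a) = 0"
    using of_nat_CHAR[where 'a='a] by simp
  \<comment> \<open>Squaring raises the exponent to \<open>2 ^ h\<close>, the field size, so
    \<open>\<gamma>\<close> is the square root of \<open>b\<close>.\<close>
  have \<gamma>: "\<gamma>\<^sup>2 = b"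
  proof -
    have "2 ^ h = 2 ^ (h - 1) * (2::nat)"
      using \<open>h > 0\<close> by (cases h) simp_all
    then show ?thesis
      using power_CARD_eq_same[of b] unfolding card \<gamma>_def by (simp only: power_mult)
  qed
  \<comment> \<open>Only the odd exponents \<open>2 * m + 1\<close> and \<open>2 * m - 1\<close>
    survive differentiation, and a sum of squares is a square in characteristic 2. This matches the
    squared multipliers with the derivative.\<close>
  have pderiv_g: "poly (pderiv g) x = (x ^ m + \<gamma> * x ^ (m - 1))\<^sup>2" for x
  proof -
    have even_0: "of_nat (2 * j) = (0 :: 'a)" for j
      by (simp add: two)
    have "2 * m - 1 = 2 * (m - 1) + 1"
      using m_pos by simp
    then have odd_1: "of_nat (2 * m + 1) = (1 :: 'a)" "of_nat (2 * m - 1) = (1 :: 'a)"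
      by (simp_all only: of_nat_add even_0 of_nat_1 add_0)
    have exps: "2 * m - 1 - 1 = (m - 1) * 2" "x ^ (2 * m) = x ^ (m * 2)"
      by (simp_all add: mult.commute)
    have "poly (pderiv g) x = x ^ (2 * m) + b * x ^ (2 * m - 1 - 1)"
      unfolding g pderiv_add pderiv_monom poly_add poly_monom odd_1 even_0 by simp
    also have "\<dots> = (x ^ m)\<^sup>2 + \<gamma>\<^sup>2 * (x ^ (m - 1))\<^sup>2"
      unfolding \<gamma> power_mult[symmetric] exps ..
    also have "\<dots> = (x ^ m + \<gamma> * x ^ (m - 1))\<^sup>2"
      unfolding power2_sum power_mult_distrib two by simp
    finally show ?thesis .
  qed
  interpret T: twisted_code m a b c "\<gamma> + a" \<eta>\<^sub>2 \<alpha> v g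
  proof
    show "(\<gamma> + a)\<^sup>2 = b + a\<^sup>2"
      unfolding power2_sum \<gamma> two by simp
    show "CARD('n) = 2 * m + 1"
      unfolding \<open>CARD('n) = _\<close> s ..
    show "poly g (\<alpha> $ i) = 0" for i
      using \<open>range (\<lambda>i. \<alpha> $ i) = _\<close> by blast
    show "(v $ i)\<^sup>2 = inverse (poly (pderiv g) (\<alpha> $ i))" for i
      unfolding \<open>\<And>i. v $ i = _\<close> fold_defs pderiv_g by (rule power_inverse)
  qed (fact char_2 m_pos g \<open>inj (\<lambda>i. \<alpha> $ i)\<close>)+
  have "S\<^sub>1 = range T.twisted"
    unfolding \<open>S\<^sub>1 = _\<close> fold_defs T.twisted_def T.U_def T.W_def by blast
  then have C\<^sub>1: "C\<^sub>1 = T.code"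
    unfolding \<open>C\<^sub>1 = _\<close> T.code_def by (simp only: image_image)
  interpret Q: self_orthogonal_code T.code h m
  proof
    show "CARD('a) = CHAR('a) ^ h"
      unfolding card char_2 ..
    show "T.code \<subseteq> euclidean_dual T.code"
      by (auto simp: T.code_def in_euclidean_dual_iff T.dot_ev_twisted)
    show "2 * m < CARD('n)"
      unfolding T.card_n by simp
  qed (fact T.subspace_code T.card_code)+
  \<comment> \<open>The length \<open>2 * m + 1\<close> exceeds twice the classical dimension
    \<open>m\<close> by exactly 1, which is the quantum dimension exponent.\<close>
  have "stabilizer_code_params Q.code_space (2 ^ s + 1) 1 (min_weight (euclidean_dual C\<^sub>1 - C\<^sub>1))"
    using Q.stabilizer_code_params_code_space unfolding C\<^sub>1 T.card_n s by simp
  then show ?thesis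
    by blast
qed

end
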